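(* Let $k$ be a field of characteristic zero, $R=k[x_0,\ldots,x_4]$, and let $$\mathcal{H}_3=\begin{pmatrix} x_0&x_1&x_2\\ x_1&x_2&x_3\\ x_2&x_3&x_4\end{pmatrix}$$ be the generic $3\times 3$ Hankel matrix. Let $J\subset R$ be the gradient ideal of $\det\mathcal{H}_3$. Then: (a) Let $P:=I_2(\mathcal{H}_3)\subset R$; then $P$ and $\mathfrak{m}:=(x_0,\ldots,x_4)$ are the only associated primes of $R/J$. (b) $\det\mathcal{H}_3$ is not homaloidal.
   Context: The gradient ideal of a polynomial is the ideal generated by all its partial derivatives. $I_2(\mathcal{H}_3)$ is the ideal generated by the $2\times 2$ minors of $\mathcal{H}_3$. A homogeneous polynomial $f\in k[x_0,\ldots,x_n]$ is called homaloidal if its polar map $\mathbb{P}^n\dashrightarrow\mathbb{P}^n$, the rational map with coordinates $(\partial f/\partial x_0:\cdots:\partial f/\partial x_n)$, is birational. *)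

theory Defs
  imports
    "HOL-Library.Poly_Mapping"
    "HOL-Library.Numeral_Type"
    "HOL-Algebra.QuotRing"
    "HOL-Algebra.Module"
    "HOL-Algebra.Algebraic_Closure_Type"
    "Jordan_Normal_Form.Determinant"
    "Jordan_Normal_Form.DL_Submatrix"
begin

section \<open>Polynomials in finitely many variables\<close>

text \<open>
  Polynomials over \<open>'k\<close> whose variables are indexed by the finite type \<open>'n\<close>, as finitely supported
  maps from exponent vectors to coefficients.
\<close>

type_synonym ('n, 'k) mpoly = "('n \<Rightarrow>\<^sub>0 nat) \<Rightarrow>\<^sub>0 'k"

definition Var :: "'n \<Rightarrow> ('n, 'k::comm_ring_1) mpoly" where
  "Var i = Poly_Mapping.single (Poly_Mapping.single i 1) 1"

definition Const :: "'k \<Rightarrow> ('n, 'k::comm_ring_1) mpoly" where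
  "Const c = Poly_Mapping.single 0 c"

text \<open>
  In a term of \<open>p\<close> where the variable \<open>i\<close> does not occur the truncated subtraction is harmless, since
  the coefficient \<open>lookup m i\<close> vanishes.
\<close>

definition partial_deriv :: "'n \<Rightarrow> ('n, 'k::comm_ring_1) mpoly \<Rightarrow> ('n, 'k) mpoly" where
  "partial_deriv i p = (\<Sum>m\<in>Poly_Mapping.keys p.
     Poly_Mapping.single (m - Poly_Mapping.single i 1)
       (of_nat (Poly_Mapping.lookup m i) * Poly_Mapping.lookup p m))"

definition subst :: "('n::finite \<Rightarrow> ('m, 'k::comm_ring_1) mpoly) \<Rightarrow> ('n, 'k) mpoly \<Rightarrow> ('m, 'k) mpoly" where
  "subst F p = (\<Sum>m\<in>Poly_Mapping.keys p.
     Const (Poly_Mapping.lookup p m) * (\<Prod>i\<in>UNIV. F i ^ Poly_Mapping.lookup m i))"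

text \<open>The zero polynomial is homogeneous of every degree.\<close>

definition homogeneous :: "nat \<Rightarrow> ('n::finite, 'k::comm_ring_1) mpoly \<Rightarrow> bool" where
  "homogeneous d p \<longleftrightarrow>
     (\<forall>m\<in>Poly_Mapping.keys p. (\<Sum>i\<in>UNIV. Poly_Mapping.lookup m i) = d)"


section \<open>Ideals and associated primes\<close>

definition quotient_module :: "'a ring \<Rightarrow> 'a set \<Rightarrow> ('a, 'a set) module" where
  "quotient_module R J =
     ring.extend (R Quot J) (module.fields (\<lambda>a Y. rcoset_mult R J (J +>\<^bsub>R\<^esub> a) Y))"

definition annihilator :: "'a ring \<Rightarrow> ('a, 'b) module \<Rightarrow> 'b \<Rightarrow> 'a set" where
  "annihilator R M x = {a \<in> carrier R. a \<odot>\<^bsub>M\<^esub> x = \<zero>\<^bsub>M\<^esub>}"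

definition associated_primes :: "'a ring \<Rightarrow> ('a, 'b) module \<Rightarrow> 'a set set" where
  "associated_primes R M = {Q. primeideal Q R \<and> (\<exists>x\<in>carrier M. Q = annihilator R M x)}"

definition gradient_ideal :: "('n, 'k::comm_ring_1) mpoly \<Rightarrow> ('n, 'k) mpoly set" where
  "gradient_ideal f = genideal ring_of_type_algebra (range (\<lambda>i. partial_deriv i f))"

definition minors :: "nat \<Rightarrow> 'a::comm_ring_1 mat \<Rightarrow> 'a set" where
  "minors t A = {det (submatrix A I J) | I J.
     I \<subseteq> {..<dim_row A} \<and> J \<subseteq> {..<dim_col A} \<and> card I = t \<and> card J = t}"

definition minors_ideal :: "nat \<Rightarrow> 'a::comm_ring_1 mat \<Rightarrow> 'a set" where
  "minors_ideal t A = genideal ring_of_type_algebra (minors t A)"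


section \<open>Rational self-maps of projective space\<close>

text \<open>
  A rational self-map of the projective space with homogeneous coordinates indexed by \<open>'n\<close> (of
  dimension \<open>CARD('n) - 1\<close>) is represented by a tuple of forms of the same degree, not all zero.
  Two such tuples represent the same map iff they are proportional over the field of fractions,
  i.e. iff their 2-by-2 minors vanish.
\<close>

definition represents_rational_map :: "('n::finite \<Rightarrow> ('n, 'k::field) mpoly) \<Rightarrow> bool" where
  "represents_rational_map F \<longleftrightarrow> (\<exists>d. \<forall>i. homogeneous d (F i)) \<and> (\<exists>i. F i \<noteq> 0)"

definition same_rational_map ::
    "('n::finite \<Rightarrow> ('n, 'k::field) mpoly) \<Rightarrow> ('n \<Rightarrow> ('n, 'k) mpoly) \<Rightarrow> bool" where
  "same_rational_map F G \<longleftrightarrow> represents_rational_map F \<and> represents_rational_map G \<and>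
     (\<forall>i j. F i * G j = F j * G i)"

text \<open>The map \<open>G\<close> after \<open>F\<close>; the composite rational map is undefined if this tuple vanishes.\<close>

definition compose_map ::
    "('n::finite \<Rightarrow> ('n, 'k::field) mpoly) \<Rightarrow> ('n \<Rightarrow> ('n, 'k) mpoly) \<Rightarrow> 'n \<Rightarrow> ('n, 'k) mpoly" where
  "compose_map G F = (\<lambda>i. subst F (G i))"

text \<open>
  Birational: there is an inverse rational map. The tuple \<open>Var\<close> represents the identity, and
  \<^const>\<open>same_rational_map\<close> includes that both composites are defined.
\<close>

definition birational :: "('n::finite \<Rightarrow> ('n, 'k::field) mpoly) \<Rightarrow> bool" where
  "birational F \<longleftrightarrow> represents_rational_map F \<and>
     (\<exists>G. represents_rational_map G \<and>
        same_rational_map (compose_map G F) Var \<and> same_rational_map (compose_map F G) Var)"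

definition polar_map :: "('n, 'k::field) mpoly \<Rightarrow> 'n \<Rightarrow> ('n, 'k) mpoly" where
  "polar_map f = (\<lambda>i. partial_deriv i f)"

definition homaloidal :: "('n::finite, 'k::field) mpoly \<Rightarrow> bool" where
  "homaloidal f \<longleftrightarrow> (\<exists>d. homogeneous d f) \<and> birational (polar_map f)"


section \<open>The generic Hankel matrix\<close>

text \<open>
  The type \<open>5\<close> has the elements 0, 1, 2, 3, 4, so that \<open>(5, 'k) mpoly\<close> is the polynomial ring in
  \<open>x\<^sub>0, \<dots>, x\<^sub>4\<close>. Its arithmetic is modulo 5, but no wrap-around occurs as \<open>i + j \<le> 4\<close>.
\<close>

definition hankel_3 :: "(5, 'k::comm_ring_1) mpoly mat" where
  "hankel_3 = mat 3 3 (\<lambda>(i, j). Var (of_nat (i + j)))"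

end

theory Submission
  imports Defs
begin

text \<open>
  Write \<open>A\<close> for the adjugate of the Hankel matrix; its six entries are the quadrics that cut out the
  rational normal quartic, parametrized by \<open>x\<^sub>i = s t\<^sup>i\<close>. Up to factors \<open>2\<close>, the five partial
  derivatives of the determinant are the entries of \<open>A\<close>, except that the corner entry \<open>u\<close> and the
  middle entry \<open>v\<close> of its antidiagonal occur only in the combination \<open>2 u + v\<close>. So the gradient ideal
  \<open>J\<close> misses exactly one quadric of \<open>P\<close>, say \<open>q = u = x\<^sub>1 x\<^sub>3 - x\<^sub>2\<^sup>2\<close>.

  (a) \<open>P = J + (q)\<close>, \<open>\<mm> q \<subseteq> J\<close> and \<open>q \<notin> J\<close>. Hence \<open>P / J\<close> is a one-dimensional vector space killed by
  \<open>\<mm>\<close>, and the associated primes of \<open>R / J\<close> are that of \<open>R / P\<close> and \<open>\<mm>\<close>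
  (\<open>associated_primes_simple_embedded\<close>). That \<open>P\<close> is prime follows by identifying it with the kernel
  of \<open>x\<^sub>i \<mapsto> s t\<^sup>i\<close>: modulo the minors, every monomial reduces to a normal form that depends only on
  its degree and its weight, and these two numbers are the exponents of \<open>s\<close> and \<open>t\<close> in its image
  (\<open>kernel_subset\<close>). The relations \<open>x\<^sub>i q \<in> J\<close> are explicit (\<open>Var_mult_extra_quadric\<close>), and \<open>q \<notin> J\<close>
  is witnessed by a linear functional on quadrics that vanishes on the five derivatives
  (\<open>extra_quadric_notin_gradient_ideal\<close>).

  (b) The entries of \<open>A\<close> satisfy one quadratic relation, because the corner and the middle
  antidiagonal entries of \<open>adj A = det(H) H\<close> are both \<open>det(H) x\<^sub>2\<close>, so that these six quadrics map
  \<open>\<P>\<^sup>4\<close> into a quadric in \<open>\<P>\<^sup>5\<close>. The polar map is this map followed by the projection that forgets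
  everything about \<open>u\<close> and \<open>v\<close> but \<open>2 u + v\<close>. Given the other coordinates, the relation is a
  quadratic equation for \<open>u\<close>, and exchanging its two roots gives a rational self-map \<open>S\<close> of \<open>\<P>\<^sup>4\<close>,
  different from the identity, that the polar map does not see (\<open>hankel_polar_deck_transformation\<close>).
  A map with a left inverse admits no such \<open>S\<close>.
\<close>

section \<open>Polynomial substitution and partial derivatives\<close>

lemma additive_induct [case_names zero add single]:
  fixes p :: "'a \<Rightarrow>\<^sub>0 'b::ab_group_add"
  assumes "Q 0" "\<And>p q. Q p \<Longrightarrow> Q q \<Longrightarrow> Q (p + q)" "\<And>m c. Q (Poly_Mapping.single m c)"
  shows "Q p"
proof (induction p rule: update_induct)
  case const
  then show ?case by (rule assms(1))
next
  case (update p m c)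
  have "Poly_Mapping.update m c p = Poly_Mapping.single m c + p"
    using update(1) by (intro poly_mapping_eqI)
      (auto simp: lookup_update lookup_add lookup_single when_def in_keys_iff)
  then show ?case using assms(2,3) update by simp
qed

text \<open>
  Substitution, partial differentiation and the lifting of the parametrization below are all sums
  over the terms of a polynomial; stating them through this extension yields additivity once for all.
\<close>

definition lin_ext :: "('a \<Rightarrow> 'b \<Rightarrow> 'c) \<Rightarrow> ('a \<Rightarrow>\<^sub>0 'b::zero) \<Rightarrow> 'c::comm_monoid_add" where
  "lin_ext g p = (\<Sum>m\<in>Poly_Mapping.keys p. g m (Poly_Mapping.lookup p m))"

lemma lin_ext_single:
  "g m 0 = 0 \<Longrightarrow> lin_ext g (Poly_Mapping.single m c) = g m c"
  by (simp add: lin_ext_def)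

lemma lin_ext_add:
  assumes "\<And>m. g m 0 = 0" "\<And>m a b. g m (a + b) = g m a + g m b"
  shows "lin_ext g (p + q) = lin_ext g p + lin_ext g (q :: _ \<Rightarrow>\<^sub>0 _::ab_group_add)"
  unfolding lin_ext_def by (rule setsum_keys_plus_distrib) (use assms in auto)

lemma Const_0 [simp]: "Const 0 = 0"
  and Const_1 [simp]: "Const 1 = 1"
  and Const_add: "Const (a + b) = Const a + Const b"
  and Const_mult: "Const (a * b) = Const a * Const b"
  by (simp_all add: Const_def single_add mult_single)

lemma Const_numeral [simp]: "Const (numeral w) = numeral w"
  by (simp add: Const_def)

lemma subst_conv_lin_ext:
  "subst F = lin_ext (\<lambda>m c. Const c * (\<Prod>i\<in>UNIV. F i ^ Poly_Mapping.lookup m i))"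
  by (simp add: subst_def lin_ext_def fun_eq_iff)

lemma subst_single:
  "subst F (Poly_Mapping.single m c) = Const c * (\<Prod>i\<in>UNIV. F i ^ Poly_Mapping.lookup m i)"
  by (simp add: subst_conv_lin_ext lin_ext_single)

lemma subst_0 [simp]: "subst F 0 = 0"
  by (simp add: subst_def)

lemma subst_add: "subst F (p + q) = subst F p + subst F q"
  unfolding subst_conv_lin_ext by (rule lin_ext_add) (auto simp: Const_add algebra_simps)

lemma subst_Const [simp]: "subst F (Const c) = Const c"
  using subst_single[of F 0 c] by (simp add: Const_def)

lemma subst_1 [simp]: "subst F 1 = 1"
  using subst_Const[of F 1] by simp

lemma subst_Var [simp]: "subst F (Var i) = F i"
proof -
  have "(\<Prod>j\<in>UNIV. F j ^ Poly_Mapping.lookup (Poly_Mapping.single i (1::nat)) j)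
      = (\<Prod>j\<in>UNIV. if i = j then F j else 1)"
    by (rule prod.cong) (auto simp: lookup_single when_def)
  then show ?thesis by (simp add: Var_def subst_single)
qed

lemma subst_mult: "subst F (p * q) = subst F p * subst F q"
proof (induction p rule: additive_induct)
  case (single m c)
  show ?case
  proof (induction q rule: additive_induct)
    case (single n d)
    then show ?case
      by (simp add: mult_single subst_single Const_mult lookup_add power_add prod.distrib ac_simps)
  qed (simp_all add: subst_add algebra_simps)
qed (simp_all add: subst_add algebra_simps)

lemma subst_uminus: "subst F (- p) = - subst F p"
  using subst_add[of F "- p" p] by (simp add: eq_neg_iff_add_eq_0)

lemma subst_diff: "subst F (p - q) = subst F p - subst F q"
  using subst_add[of F p "- q"] by (simp add: subst_uminus)

lemma subst_power: "subst F (p ^ n) = subst F p ^ n"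
  by (induction n) (simp_all add: subst_mult)

lemma subst_numeral [simp]: "subst F (numeral w) = numeral w"
  using subst_Const[of F "numeral w"] by simp

lemma subst_sum: "subst F (\<Sum>x\<in>A. f x) = (\<Sum>x\<in>A. subst F (f x))"
  by (induction A rule: infinite_finite_induct) (simp_all add: subst_add)

lemma subst_prod: "subst F (\<Prod>x\<in>A. f x) = (\<Prod>x\<in>A. subst F (f x))"
  by (induction A rule: infinite_finite_induct) (simp_all add: subst_mult)

lemmas subst_hom = subst_add subst_diff subst_uminus subst_mult subst_power

lemma subst_subst: "subst S (subst F p) = subst (\<lambda>i. subst S (F i)) p"
  by (simp add: subst_def[of F] subst_sum subst_mult subst_prod subst_power)
     (simp add: subst_def)

text \<open>A homogeneous form does not see, up to a power, a common factor of its arguments.\<close>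

lemma subst_scale_homogeneous:
  assumes "homogeneous e p"
  shows "subst (\<lambda>i. D * F i) p = D ^ e * subst F p"
proof -
  have "Const (Poly_Mapping.lookup p m) * (\<Prod>i\<in>UNIV. (D * F i) ^ Poly_Mapping.lookup m i) =
      D ^ e * (Const (Poly_Mapping.lookup p m) * (\<Prod>i\<in>UNIV. F i ^ Poly_Mapping.lookup m i))"
    if "m \<in> Poly_Mapping.keys p" for m
    using assms that
    by (simp add: homogeneous_def power_mult_distrib prod.distrib power_sum[symmetric] ac_simps)
  then show ?thesis
    by (simp add: subst_def sum_distrib_left)
qed

lemma prod_single:
  "(\<Prod>i\<in>I. Poly_Mapping.single (e i) (c i)) = Poly_Mapping.single (\<Sum>i\<in>I. e i) (\<Prod>i\<in>I. c i)"
  by (induction I rule: infinite_finite_induct) (simp_all add: mult_single)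

lemma Var_power: "Var i ^ n = Poly_Mapping.single (Poly_Mapping.single i n) 1"
  by (induction n) (simp_all add: Var_def mult_single flip: single_add)

lemma subst_Var_id: "subst Var p = p"
proof (induction p rule: additive_induct)
  case (single m c)
  have "(\<Sum>i\<in>UNIV. Poly_Mapping.single i (Poly_Mapping.lookup m i)) = m"
    by (rule poly_mapping_eqI) (simp add: lookup_sum lookup_single when_def)
  then show ?case
    by (simp add: subst_single Var_power prod_single Const_def mult_single)
qed (simp_all add: subst_add)

lemma partial_deriv_conv_lin_ext:
  "partial_deriv i = lin_ext (\<lambda>m c. Poly_Mapping.single (m - Poly_Mapping.single i 1)
     (of_nat (Poly_Mapping.lookup m i) * c))"
  by (simp add: partial_deriv_def lin_ext_def fun_eq_iff)

lemma partial_deriv_single: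
  "partial_deriv i (Poly_Mapping.single m c) =
     Poly_Mapping.single (m - Poly_Mapping.single i 1) (of_nat (Poly_Mapping.lookup m i) * c)"
  by (simp add: partial_deriv_conv_lin_ext lin_ext_single)

lemma partial_deriv_0 [simp]: "partial_deriv i 0 = 0"
  by (simp add: partial_deriv_def)

lemma partial_deriv_add: "partial_deriv i (p + q) = partial_deriv i p + partial_deriv i q"
  unfolding partial_deriv_conv_lin_ext
  by (rule lin_ext_add) (auto simp: single_add algebra_simps)

lemma partial_deriv_uminus: "partial_deriv i (- p) = - partial_deriv i p"
  using partial_deriv_add[of i "- p" p] by (simp add: eq_neg_iff_add_eq_0)

lemma partial_deriv_diff: "partial_deriv i (p - q) = partial_deriv i p - partial_deriv i q"
  using partial_deriv_add[of i p "- q"] by (simp add: partial_deriv_uminus)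

lemma partial_deriv_Var: "partial_deriv i (Var j) = (if i = j then 1 else 0)"
  by (auto simp: Var_def partial_deriv_single lookup_single when_def)

lemma partial_deriv_mult:
  "partial_deriv i (p * q) = partial_deriv i p * q + p * partial_deriv i q"
proof (induction p rule: additive_induct)
  case (single m c)
  show ?case
  proof (induction q rule: additive_induct)
    case (single n d)
    let ?e = "Poly_Mapping.single i (1::nat)"
    have shift: "a - ?e + b = a + b - ?e" if "Poly_Mapping.lookup a i \<noteq> 0" for a b
      using that by (intro poly_mapping_eqI) (auto simp: lookup_add lookup_minus lookup_single when_def)
    have "Poly_Mapping.single (m - ?e + n) (of_nat (Poly_Mapping.lookup m i) * (c * d)) =
        Poly_Mapping.single (m + n - ?e) (of_nat (Poly_Mapping.lookup m i) * (c * d))"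
      by (cases "Poly_Mapping.lookup m i = 0") (simp_all add: shift del: One_nat_def)
    moreover have "Poly_Mapping.single (n - ?e + m) (of_nat (Poly_Mapping.lookup n i) * (c * d)) =
        Poly_Mapping.single (n + m - ?e) (of_nat (Poly_Mapping.lookup n i) * (c * d))"
      by (cases "Poly_Mapping.lookup n i = 0") (simp_all add: shift del: One_nat_def)
    ultimately show ?case
      by (simp add: mult_single partial_deriv_single lookup_add single_add algebra_simps)
  qed (simp_all add: partial_deriv_add algebra_simps)
qed (simp_all add: partial_deriv_add algebra_simps)

section \<open>The determinant of the Hankel matrix and its derivatives\<close>

abbreviation x0 :: "(5, 'k::comm_ring_1) mpoly" where "x0 \<equiv> Var 0"
abbreviation x1 :: "(5, 'k::comm_ring_1) mpoly" where "x1 \<equiv> Var 1"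
abbreviation x2 :: "(5, 'k::comm_ring_1) mpoly" where "x2 \<equiv> Var 2"
abbreviation x3 :: "(5, 'k::comm_ring_1) mpoly" where "x3 \<equiv> Var 3"
abbreviation x4 :: "(5, 'k::comm_ring_1) mpoly" where "x4 \<equiv> Var 4"

lemma UNIV_5: "(UNIV :: 5 set) = {0, 1, 2, 3, 4}"
proof -
  have "card {0, 1, 2, 3, 4 :: 5} = card (UNIV :: 5 set)"
    by simp
  then show ?thesis by (metis card_subset_eq finite subset_UNIV)
qed

lemma forall_5: "(\<forall>i::5. Q i) \<longleftrightarrow> Q 0 \<and> Q 1 \<and> Q 2 \<and> Q 3 \<and> Q 4"
  using UNIV_5 by (metis UNIV_I empty_iff insert_iff)

lemma det_2: "A \<in> carrier_mat 2 2 \<Longrightarrow> det A = A $$ (0,0) * A $$ (1,1) - A $$ (0,1) * A $$ (1,0)"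
  for A :: "'a::comm_ring_1 mat"
  by (subst laplace_expansion_row[of _ 2 0]) (auto simp: cofactor_def mat_delete_def numeral_2_eq_2 det_single)

lemma det_hankel_3:
  "det hankel_3 = x0 * x2 * x4 + 2 * x1 * x2 * x3 - x2 * x2 * x2 - x0 * x3 * x3 - x1 * x1 * x4"
proof -
  have "det hankel_3 = (\<Sum>j<3. hankel_3 $$ (0, j) * cofactor hankel_3 0 j)"
    by (rule laplace_expansion_row) (auto simp: hankel_3_def)
  also have "\<dots> = hankel_3 $$ (0, 0) * cofactor hankel_3 0 0
      + hankel_3 $$ (0, 1) * cofactor hankel_3 0 1 + hankel_3 $$ (0, 2) * cofactor hankel_3 0 2"
    by (simp add: numeral_3_eq_3 numeral_2_eq_2)
  also have "\<dots> = x0 * x2 * x4 + 2 * x1 * x2 * x3 - x2 * x2 * x2 - x0 * x3 * x3 - x1 * x1 * x4"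
    unfolding cofactor_def
    by (subst (1 2 3) det_2) (auto simp: hankel_3_def mat_delete_def algebra_simps)
  finally show ?thesis .
qed

lemma partial_deriv_numeral: "partial_deriv i (numeral w) = 0"
  unfolding single_numeral[symmetric] by (simp add: partial_deriv_single del: single_numeral)

lemma polar_map_det_hankel_3:
  "polar_map (det hankel_3) 0 = x2 * x4 - x3 ^ 2"
  "polar_map (det hankel_3) 1 = 2 * (x2 * x3 - x1 * x4)"
  "polar_map (det hankel_3) 2 = x0 * x4 + 2 * x1 * x3 - 3 * x2 ^ 2"
  "polar_map (det hankel_3) 3 = 2 * (x1 * x2 - x0 * x3)"
  "polar_map (det hankel_3) 4 = x0 * x2 - x1 ^ 2"
  by (simp_all add: polar_map_def det_hankel_3 partial_deriv_add partial_deriv_diff partial_deriv_mult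
      partial_deriv_Var partial_deriv_numeral power2_eq_square algebra_simps)

lemma gradient_ideal_conv_polar_map: "gradient_ideal f = genideal ring_of_type_algebra (range (polar_map f))"
  by (simp add: gradient_ideal_def polar_map_def)

lemma range_polar_map_det_hankel_3:
  "range (polar_map (det hankel_3)) = {x2 * x4 - x3 ^ 2, 2 * (x2 * x3 - x1 * x4),
     x0 * x4 + 2 * x1 * x3 - 3 * x2 ^ 2, 2 * (x1 * x2 - x0 * x3), x0 * x2 - x1 ^ 2}"
  by (simp add: UNIV_5 polar_map_det_hankel_3 image_Un)

section \<open>Ideals and associated primes over a commutative ring type\<close>

lemma ideal_type_algebra_iff:
  "ideal I (ring_of_type_algebra :: 'a::comm_ring_1 ring) \<longleftrightarrow>
     0 \<in> I \<and> (\<forall>a\<in>I. \<forall>b\<in>I. a + b \<in> I) \<and> (\<forall>r. \<forall>a\<in>I. r * a \<in> I)"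
  (is "ideal I ?R \<longleftrightarrow> ?rhs")
proof
  assume "ideal I ?R"
  then interpret ideal I ?R .
  show ?rhs
    using additive_subgroup.zero_closed[OF is_additive_subgroup]
      additive_subgroup.a_closed[OF is_additive_subgroup] I_l_closed
    by (auto simp: ring_of_type_algebra_def)
next
  assume rhs: ?rhs
  interpret cring ?R by (rule cring_from_type_algebra)
  have minus: "\<ominus>\<^bsub>?R\<^esub> a = - a" for a
    using minus_equality[of "- a" a] by (auto simp: ring_of_type_algebra_def)
  have neg: "\<ominus>\<^bsub>?R\<^esub> a \<in> I" if "a \<in> I" for a
  proof -
    have "(- 1) * a \<in> I" using rhs that by blast
    then show ?thesis by (simp add: minus)
  qed
  have right_mem: "a * r \<in> I" if "a \<in> I" for a r
    using rhs that by (metis mult.commute)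
  show "ideal I ?R"
  proof (rule idealI[OF ring_axioms])
    show "subgroup I (add_monoid ?R)"
      by (rule add.subgroupI) (use rhs neg in \<open>auto simp: ring_of_type_algebra_def a_inv_def\<close>)
  qed (use rhs in \<open>auto simp: ring_of_type_algebra_def right_mem\<close>)
qed

lemma ideal_diff:
  assumes "ideal I (ring_of_type_algebra :: 'a::comm_ring_1 ring)" "a \<in> I" "b \<in> I"
  shows "a - b \<in> I"
proof -
  have "a + (- 1) * b \<in> I" using assms unfolding ideal_type_algebra_iff by blast
  then show ?thesis by simp
qed

lemma ideal_mult_cong:
  assumes "ideal I (ring_of_type_algebra :: 'a::comm_ring_1 ring)" "a - b \<in> I" "c - d \<in> I"
  shows "a * c - b * d \<in> I"
proof -
  have "c * (a - b) + b * (c - d) \<in> I" using assms unfolding ideal_type_algebra_iff by blast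
  then show ?thesis by (simp add: algebra_simps)
qed

lemma ideal_trans_cong:
  assumes "ideal I (ring_of_type_algebra :: 'a::comm_ring_1 ring)" "a - b \<in> I" "b - c \<in> I"
  shows "a - c \<in> I"
proof -
  have "(a - b) + (b - c) \<in> I" using assms unfolding ideal_type_algebra_iff by blast
  then show ?thesis by simp
qed

lemma primeideal_type_algebra_iff:
  "primeideal I (ring_of_type_algebra :: 'a::comm_ring_1 ring) \<longleftrightarrow>
     ideal I ring_of_type_algebra \<and> 1 \<notin> I \<and> (\<forall>a b. a * b \<in> I \<longrightarrow> a \<in> I \<or> b \<in> I)"
  (is "primeideal I ?R \<longleftrightarrow> ?rhs")
proof
  assume "primeideal I ?R"
  then interpret primeideal I ?R .
  have "1 \<notin> I" using I_notcarr one_imp_carrier by (auto simp: ring_of_type_algebra_def)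
  then show ?rhs using is_ideal I_prime by (auto simp: ring_of_type_algebra_def)
next
  assume ?rhs
  then show "primeideal I ?R"
    by (intro primeidealI cring_from_type_algebra) (auto simp: ring_of_type_algebra_def)
qed

lemma genideal_type_algebra:
  fixes S :: "'a::comm_ring_1 set"
  shows "ideal (genideal ring_of_type_algebra S) ring_of_type_algebra"
    and "S \<subseteq> genideal ring_of_type_algebra S"
    and "ideal I ring_of_type_algebra \<Longrightarrow> S \<subseteq> I \<Longrightarrow> genideal ring_of_type_algebra S \<subseteq> I"
proof -
  interpret cring "ring_of_type_algebra :: 'a ring" by (rule cring_from_type_algebra)
  have *: "S \<subseteq> carrier ring_of_type_algebra" by (simp add: ring_of_type_algebra_def)
  show "ideal (genideal ring_of_type_algebra S) ring_of_type_algebra"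
    by (rule genideal_ideal[OF *])
  show "S \<subseteq> genideal ring_of_type_algebra S"
    by (rule genideal_self[OF *])
  show "ideal I ring_of_type_algebra \<Longrightarrow> S \<subseteq> I \<Longrightarrow> genideal ring_of_type_algebra S \<subseteq> I"
    by (rule genideal_minimal)
qed

text \<open>
  The annihilator of the coset of \<open>x\<close> is the colon ideal \<open>(J : x)\<close>, because \<open>a\<close> acts on the coset of
  \<open>x\<close> by sending it to the coset of \<open>a * x\<close>.
\<close>

lemma associated_primes_quotient:
  fixes J :: "'a::comm_ring_1 set"
  assumes "ideal J ring_of_type_algebra"
  shows "associated_primes ring_of_type_algebra (quotient_module ring_of_type_algebra J) =
    {Q. primeideal Q ring_of_type_algebra \<and> (\<exists>x. Q = {a. a * x \<in> J})}"
proof -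
  let ?R = "ring_of_type_algebra :: 'a ring"
  let ?M = "quotient_module ?R J"
  interpret ideal J ?R by fact
  have carrier_R: "carrier ?R = UNIV" by (simp add: ring_of_type_algebra_def)
  have carrier_M: "carrier ?M = range (\<lambda>x. J +>\<^bsub>?R\<^esub> x)"
    by (auto simp: quotient_module_def ring.defs module.defs FactRing_def A_RCOSETS_def'
        a_r_coset_def' carrier_R)
  have coset: "J +>\<^bsub>?R\<^esub> x = J \<longleftrightarrow> x \<in> J" for x
    using a_rcos_self[of x] a_rcos_const[of x] by (auto simp: carrier_R)
  have "annihilator ?R ?M (J +>\<^bsub>?R\<^esub> x) = {a. a * x \<in> J}" for x
  proof -
    have "a \<odot>\<^bsub>?M\<^esub> (J +>\<^bsub>?R\<^esub> x) = J +>\<^bsub>?R\<^esub> (a * x)" for a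
      using rcoset_mult_add[of a x]
      by (simp add: quotient_module_def ring.defs module.defs carrier_R)
         (simp add: ring_of_type_algebra_def)
    moreover have "\<zero>\<^bsub>?M\<^esub> = J"
      by (simp add: quotient_module_def ring.defs module.defs FactRing_def)
    ultimately show ?thesis
      by (simp add: annihilator_def coset carrier_R)
  qed
  then show ?thesis
    by (simp add: associated_primes_def carrier_M)
qed

text \<open>
  The situation is that \<open>P / J\<close> is generated by the class of \<open>q\<close> and killed by \<open>\<mm>\<close>. An
  element \<open>x\<close> of \<open>P\<close> is then killed by \<open>\<mm>\<close>, so that its annihilator, if proper, is \<open>\<mm>\<close>. For \<open>x\<close>
  outside \<open>P\<close> the annihilator lies in \<open>P\<close>; if it is prime it contains \<open>q\<close>, because it contains
  \<open>y q\<close> but not \<open>y\<close>, and hence it contains all of \<open>P\<close>. The two primes do occur, as the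
  annihilators of \<open>y\<close> and of \<open>q\<close>.
\<close>

lemma associated_primes_simple_embedded:
  fixes J P \<mm> :: "'a::comm_ring_1 set"
  assumes J: "ideal J ring_of_type_algebra"
    and P: "primeideal P ring_of_type_algebra"
    and \<mm>: "primeideal \<mm> ring_of_type_algebra"
    and \<mm>_max: "\<And>I. ideal I ring_of_type_algebra \<Longrightarrow> 1 \<notin> I \<Longrightarrow> \<mm> \<subseteq> I \<Longrightarrow> I = \<mm>"
    and "J \<subseteq> P" and q: "q \<in> P" "q \<notin> J"
    and P_gen: "\<And>p. p \<in> P \<Longrightarrow> \<exists>j\<in>J. \<exists>c. p = j + c * q"
    and \<mm>_q: "\<And>a. a \<in> \<mm> \<Longrightarrow> a * q \<in> J"
    and y: "y \<in> \<mm>" "y \<notin> P"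
  shows "associated_primes ring_of_type_algebra (quotient_module ring_of_type_algebra J) = {P, \<mm>}"
proof -
  note J' = J[unfolded ideal_type_algebra_iff]
  note P' = P[unfolded primeideal_type_algebra_iff ideal_type_algebra_iff]
  have ann_ideal: "ideal {a. a * x \<in> J} ring_of_type_algebra" for x
    using J' by (auto simp: ideal_type_algebra_iff algebra_simps)
  have \<mm>_P: "a * p \<in> J" if "a \<in> \<mm>" "p \<in> P" for a p
  proof -
    obtain j c where "j \<in> J" and p: "p = j + c * q" using P_gen[OF \<open>p \<in> P\<close>] by blast
    have "a * j + c * (a * q) \<in> J" using J' \<open>j \<in> J\<close> \<mm>_q[OF \<open>a \<in> \<mm>\<close>] by blast
    then show ?thesis by (simp add: p algebra_simps)
  qed
  have "a * y \<in> J" if "a \<in> P" for a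
    using \<mm>_P[OF y(1) that] by (simp add: mult.commute)
  moreover have "a \<in> P" if "a * y \<in> J" for a
    using that P' \<open>J \<subseteq> P\<close> y(2) by blast
  ultimately have "P = {a. a * y \<in> J}"
    by blast
  moreover have "\<mm> = {a. a * q \<in> J}"
    using \<mm>_max[OF ann_ideal] \<mm>_q q(2) by auto
  moreover have "Q = P \<or> Q = \<mm>"
    if Q: "primeideal Q ring_of_type_algebra" and Qx: "Q = {a. a * x \<in> J}" for Q x
  proof (cases "x \<in> P")
    case True
    then have "\<mm> \<subseteq> Q" using \<mm>_P by (auto simp: Qx)
    then show ?thesis using \<mm>_max[of Q] Q by (simp add: primeideal_type_algebra_iff)
  next
    case False
    note Q' = Q[unfolded primeideal_type_algebra_iff ideal_type_algebra_iff]
    have "Q \<subseteq> P" using False P' \<open>J \<subseteq> P\<close> unfolding Qx by blast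
    have "J \<subseteq> Q" using J' by (auto simp: Qx mult.commute[of _ x])
    have "y * q \<in> Q" using \<mm>_q[OF y(1)] \<open>J \<subseteq> Q\<close> by blast
    then have "q \<in> Q" using Q' \<open>Q \<subseteq> P\<close> y(2) by blast
    have "P \<subseteq> Q"
    proof
      fix p assume "p \<in> P"
      then obtain j c where "j \<in> J" "p = j + c * q" using P_gen by blast
      then show "p \<in> Q" using Q' \<open>q \<in> Q\<close> \<open>J \<subseteq> Q\<close> by blast
    qed
    with \<open>Q \<subseteq> P\<close> show ?thesis by blast
  qed
  ultimately show ?thesis
    unfolding associated_primes_quotient[OF J] using P \<mm> by blast
qed

text \<open>
  The linear order on the variables of the target serves to make its polynomial ring an integral domain.
\<close>

lemma primeideal_kernel_subst:
  fixes F :: "'n::finite \<Rightarrow> ('m::linorder, 'k::idom) mpoly"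
  shows "primeideal {p. subst F p = 0} ring_of_type_algebra"
  by (auto simp: primeideal_type_algebra_iff ideal_type_algebra_iff subst_hom)

lemma subst_cong_ideal:
  fixes F G :: "'n::finite \<Rightarrow> ('m, 'k::comm_ring_1) mpoly"
  assumes I: "ideal I ring_of_type_algebra" and FG: "\<And>i. F i - G i \<in> I"
  shows "subst F p - subst G p \<in> I"
proof (induction p rule: additive_induct)
  case zero
  then show ?case using I by (simp add: ideal_type_algebra_iff)
next
  case (add p q)
  then have "(subst F p - subst G p) + (subst F q - subst G q) \<in> I"
    using I unfolding ideal_type_algebra_iff by blast
  then show ?case by (simp add: subst_add algebra_simps)
next
  case (single m c)
  have power: "F i ^ n - G i ^ n \<in> I" for i n
    by (induction n) (use I FG in \<open>auto intro: ideal_mult_cong simp: ideal_type_algebra_iff\<close>)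
  have "(\<Prod>i\<in>A. F i ^ Poly_Mapping.lookup m i) - (\<Prod>i\<in>A. G i ^ Poly_Mapping.lookup m i) \<in> I" for A
    by (induction A rule: infinite_finite_induct)
       (use I power in \<open>auto intro!: ideal_mult_cong simp: ideal_type_algebra_iff\<close>)
  moreover have "Const c - Const c \<in> I" using I by (simp add: ideal_type_algebra_iff)
  ultimately show ?case by (simp add: subst_single ideal_mult_cong[OF I])
qed

text \<open>
  Substituting \<open>0\<close> instead of the variables changes a polynomial only by an element of the ideal that
  they generate. As a kernel the ideal is prime over every domain.
\<close>

lemma irrelevant_ideal_eq_kernel:
  "genideal ring_of_type_algebra (range Var) =
     {p :: ('n::finite, 'k::comm_ring_1) mpoly. subst (\<lambda>_. 0 :: ('n, 'k) mpoly) p = 0}"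
  (is "?\<mm> = ?K")
proof
  have "ideal ?K ring_of_type_algebra"
    by (auto simp: ideal_type_algebra_iff subst_hom)
  then show "?\<mm> \<subseteq> ?K" by (rule genideal_type_algebra(3)) auto
  show "?K \<subseteq> ?\<mm>"
  proof
    fix p assume "p \<in> ?K"
    have "subst Var p - subst (\<lambda>_. 0) p \<in> ?\<mm>"
      by (rule subst_cong_ideal[OF genideal_type_algebra(1)]) (use genideal_type_algebra(2)[of "range Var"] in auto)
    with \<open>p \<in> ?K\<close> show "p \<in> ?\<mm>" by (simp add: subst_Var_id)
  qed
qed

lemma subst_zero_is_Const:
  fixes p :: "('n::finite, 'k::comm_ring_1) mpoly"
  shows "\<exists>c. subst (\<lambda>_. 0 :: ('m, 'k) mpoly) p = Const c"
proof (induction p rule: additive_induct)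
  case zero
  show ?case by (rule exI[of _ 0]) simp
next
  case (add p q)
  then show ?case by (metis Const_add subst_add)
next
  case (single m c)
  have "(\<Prod>i\<in>A. 0 ^ Poly_Mapping.lookup m i) \<in> {0, 1 :: ('m, 'k) mpoly}" for A :: "'n set"
    by (induction A rule: infinite_finite_induct) (auto simp: power_0_left)
  from this[of UNIV] have "subst (\<lambda>_. 0 :: ('m, 'k) mpoly) (Poly_Mapping.single m c) \<in> {Const 0, Const c}"
    by (auto simp: subst_single)
  then show ?case by blast
qed

lemma irrelevant_ideal_maximal:
  fixes I :: "('n::finite, 'k::field) mpoly set"
  assumes I: "ideal I ring_of_type_algebra" "1 \<notin> I"
    and sub: "genideal ring_of_type_algebra (range Var) \<subseteq> I"
  shows "I = genideal ring_of_type_algebra (range Var)"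
proof
  show "I \<subseteq> genideal ring_of_type_algebra (range Var)"
  proof
    fix p assume "p \<in> I"
    obtain c where c: "subst (\<lambda>_. 0 :: ('n, 'k) mpoly) p = Const c"
      using subst_zero_is_Const by blast
    have "p - Const c \<in> I"
      using sub c by (auto simp: irrelevant_ideal_eq_kernel subst_hom)
    with \<open>p \<in> I\<close> have "p - (p - Const c) \<in> I" by (rule ideal_diff[OF I(1)])
    then have "Const (inverse c) * Const c \<in> I"
      using I(1) unfolding ideal_type_algebra_iff by simp
    with \<open>1 \<notin> I\<close> have "c = 0" by (cases "c = 0") (simp_all flip: Const_mult)
    with c show "p \<in> genideal ring_of_type_algebra (range Var)"
      by (simp add: irrelevant_ideal_eq_kernel)
  qed
qed (rule sub)

section \<open>The ideal of the rational normal quartic\<close>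

lemma two_element_set_conv:
  fixes I :: "nat set"
  shows "I \<subseteq> {..<n} \<and> card I = 2 \<longleftrightarrow> (\<exists>a b. a < b \<and> b < n \<and> I = {a, b})"
proof
  assume I: "I \<subseteq> {..<n} \<and> card I = 2"
  then obtain a b where "I = {a, b}" "a \<noteq> b" by (auto simp: card_2_iff)
  then show "\<exists>a b. a < b \<and> b < n \<and> I = {a, b}"
    using I by (cases a b rule: linorder_cases) auto
qed auto

lemma det_submatrix_2:
  fixes A :: "'a::comm_ring_1 mat"
  assumes ab: "a < b" "b < dim_row A" and cd: "c < d" "d < dim_col A"
  shows "det (submatrix A {a, b} {c, d}) = A $$ (a, c) * A $$ (b, d) - A $$ (a, d) * A $$ (b, c)"
proof -
  have below: "{k \<in> {i, j}. k < i} = {}" "{k \<in> {i, j}. k < j} = {i}" if "i < j" for i j :: nat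
    using that by auto
  have "{i. i < dim_row A \<and> i \<in> {a, b}} = {a, b}" "{j. j < dim_col A \<and> j \<in> {c, d}} = {c, d}"
    "card {a, b} = 2" "card {c, d} = 2"
    using assms by auto
  then have "submatrix A {a, b} {c, d} \<in> carrier_mat 2 2"
    by (intro carrier_matI) (simp_all only: dim_submatrix)
  moreover have "submatrix A {a, b} {c, d} $$ (card {k \<in> {a, b}. k < i}, card {k \<in> {c, d}. k < j}) = A $$ (i, j)"
    if "i = a \<or> i = b" "j = c \<or> j = d" for i j
    using that assms by (intro submatrix_index_card) auto
  note this[of a c] this[of a d] this[of b c] this[of b d]
  ultimately show ?thesis
    by (simp add: det_2 below[OF ab(1)] below[OF cd(1)] del: insert_iff Collect_conv_if)
qed

lemma minors_2_eq:
  fixes A :: "'a::comm_ring_1 mat"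
  shows "minors 2 A = {A $$ (a, c) * A $$ (b, d) - A $$ (a, d) * A $$ (b, c) | a b c d.
    a < b \<and> b < dim_row A \<and> c < d \<and> d < dim_col A}"
proof -
  have "minors 2 A = {det (submatrix A I J) | I J.
     (I \<subseteq> {..<dim_row A} \<and> card I = 2) \<and> (J \<subseteq> {..<dim_col A} \<and> card J = 2)}"
    unfolding minors_def by blast
  also have "\<dots> = {det (submatrix A {a, b} {c, d}) | a b c d.
    a < b \<and> b < dim_row A \<and> c < d \<and> d < dim_col A}"
    unfolding two_element_set_conv by blast
  also have "\<dots> = {A $$ (a, c) * A $$ (b, d) - A $$ (a, d) * A $$ (b, c) | a b c d.
    a < b \<and> b < dim_row A \<and> c < d \<and> d < dim_col A}"
    by (simp add: det_submatrix_2 cong: rev_conj_cong)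
  finally show ?thesis .
qed

text \<open>
  The exponent \<open>i\<close> of \<open>x\<^sub>i \<mapsto> s t\<^sup>i\<close>, as a natural number: indices of type \<open>5\<close> are residues, and
  weights have to be added without reduction.
\<close>

definition weight :: "5 \<Rightarrow> nat" where
  "weight i = (if i = 1 then 1 else if i = 2 then 2 else if i = 3 then 3 else if i = 4 then 4 else 0)"

lemma weight_simps [simp]:
  "weight 0 = 0" "weight 1 = 1" "weight 2 = 2" "weight 3 = 3" "weight 4 = 4"
  by (simp_all add: weight_def)

lemma weight_of_nat: "n \<le> 4 \<Longrightarrow> weight (of_nat n) = n"
proof -
  assume "n \<le> 4"
  then have "n = 0 \<or> n = 1 \<or> n = 2 \<or> n = 3 \<or> n = 4" by linarith
  then show "weight (of_nat n) = n" by (elim disjE) simp_all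
qed

lemma weight_le: "weight i \<le> 4" and of_nat_weight: "of_nat (weight i) = i"
proof -
  have "\<forall>i. weight i \<le> 4 \<and> of_nat (weight i) = i" by (simp add: forall_5)
  then show "weight i \<le> 4" "of_nat (weight i) = i" by auto
qed

definition rational_normal_curve :: "5 \<Rightarrow> (2, 'k::comm_ring_1) mpoly" where
  "rational_normal_curve i = Var 0 * Var 1 ^ weight i"

text \<open>
  The representative of the monomials of degree \<open>d\<close> and weight \<open>w\<close>, for \<open>w \<le> 4 * d\<close>: as many factors
  \<open>x\<^sub>4\<close> as the weight permits, at most one middle variable, and \<open>x\<^sub>0\<close> for the rest.
\<close>

fun normal_form :: "nat \<Rightarrow> nat \<Rightarrow> (5, 'k::comm_ring_1) mpoly" where
  "normal_form 0 w = 1"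
| "normal_form (Suc d) w =
     (if w \<le> 4 then Var (of_nat w) * x0 ^ d else x4 * normal_form d (w - 4))"

text \<open>
  An ideal that contains the minors allows every monomial to be straightened to its normal form. The
  argument is needed for \<open>P\<close> itself, to see that it is the whole kernel of the parametrization, and
  for \<open>J + (q)\<close>, to see that it is all of \<open>P\<close>.
\<close>

locale straightening =
  fixes I :: "(5, 'k::comm_ring_1) mpoly set"
  assumes ideal: "ideal I ring_of_type_algebra"
    and minors: "x0 * x2 - x1 ^ 2 \<in> I" "x0 * x3 - x1 * x2 \<in> I" "x1 * x3 - x2 ^ 2 \<in> I"
      "x0 * x4 - x2 ^ 2 \<in> I" "x1 * x4 - x2 * x3 \<in> I" "x2 * x4 - x3 ^ 2 \<in> I"
begin

lemma zero_mem: "0 \<in> I" and add_mem: "a \<in> I \<Longrightarrow> b \<in> I \<Longrightarrow> a + b \<in> I"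
  and mult_mem: "a \<in> I \<Longrightarrow> r * a \<in> I"
  using ideal unfolding ideal_type_algebra_iff by blast+

lemma neg_minors: "x1 ^ 2 - x0 * x2 \<in> I" "x1 * x2 - x0 * x3 \<in> I" "x1 * x3 - x0 * x4 \<in> I"
  "x2 ^ 2 - x0 * x4 \<in> I" "x2 * x3 - x1 * x4 \<in> I" "x3 ^ 2 - x2 * x4 \<in> I"
  using minors(1,2,4,5,6)[THEN mult_mem[of _ "-1"]]  ideal_diff[OF ideal minors(3,4)]
  by (simp_all add: algebra_simps)

text \<open>
  The minors say that a product of two variables may be replaced by any other of the same weight;
  one of the factors can always be made extreme.
\<close>

lemma exchange:
  assumes "i \<le> 4" "j \<le> 4"
  shows "Var (of_nat i) * Var (of_nat j)
    - (if i + j \<le> 4 then x0 * Var (of_nat (i + j)) else x4 * Var (of_nat (i + j - 4))) \<in> I"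
proof -
  have "i \<in> {0,1,2,3,4}" "j \<in> {0,1,2,3,4}" using assms by auto
  then show ?thesis
    using neg_minors zero_mem by (auto simp: power2_eq_square mult.commute)
qed

lemma Var_mult_normal_form:
  assumes "i \<le> 4" "w \<le> 4 * d"
  shows "Var (of_nat i) * normal_form d w - normal_form (Suc d) (w + i) \<in> I"
  using assms(2)
proof (induction d arbitrary: w)
  case 0
  then show ?case using zero_mem \<open>i \<le> 4\<close> by simp
next
  case (Suc d)
  show ?case
  proof (cases "w \<le> 4")
    case True
    have "x0 ^ d * (Var (of_nat i) * Var (of_nat w)
      - (if i + w \<le> 4 then x0 * Var (of_nat (i + w)) else x4 * Var (of_nat (i + w - 4)))) \<in> I"
      by (rule mult_mem[OF exchange]) (use \<open>i \<le> 4\<close> True in auto)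
    then show ?thesis
      using True \<open>i \<le> 4\<close> by (auto simp: algebra_simps split: if_splits)
  next
    case False
    have "x4 * (Var (of_nat i) * normal_form d (w - 4) - normal_form (Suc d) (w - 4 + i)) \<in> I"
      by (rule mult_mem[OF Suc.IH]) (use Suc.prems in auto)
    note step = this[unfolded right_diff_distrib mult.left_commute[of x4 "Var (of_nat i)"]]
    have 1: "normal_form (Suc (Suc d)) (w + i) = x4 * normal_form (Suc d) (w - 4 + i)"
      using False by (simp del: normal_form.simps(2) add: normal_form.simps(2)[of "Suc d"])
    have 2: "normal_form (Suc d) w = x4 * normal_form d (w - 4)"
      using False by simp
    show ?thesis
      unfolding 1 2 by (rule step)
  qed
qed

lemma Var_power_mult_normal_form:
  assumes "w \<le> 4 * d"
  shows "Var i ^ n * normal_form d w - normal_form (n + d) (n * weight i + w) \<in> I"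
proof (induction n)
  case 0
  then show ?case using zero_mem by simp
next
  case (Suc n)
  have "Var i * (Var i ^ n * normal_form d w - normal_form (n + d) (n * weight i + w)) \<in> I"
    by (rule mult_mem[OF Suc.IH])
  note step = this[unfolded right_diff_distrib]
  have "Var i * normal_form (n + d) (n * weight i + w)
      - normal_form (Suc (n + d)) (n * weight i + w + weight i) \<in> I"
    using Var_mult_normal_form[OF weight_le[of i], of "n * weight i + w" "n + d"]
      mult_le_mono2[OF weight_le[of i], of n] assms
    by (simp add: of_nat_weight algebra_simps)
  from ideal_trans_cong[OF ideal step this] show ?case
    by (simp add: ac_simps del: normal_form.simps)
qed

lemma monomial_normal_form:
  "(\<Prod>i\<in>A. Var i ^ m i) - normal_form (\<Sum>i\<in>A. m i) (\<Sum>i\<in>A. m i * weight i) \<in> I"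
proof (induction A rule: infinite_finite_induct)
  case (insert i A)
  have "Var i ^ m i * ((\<Prod>i\<in>A. Var i ^ m i) - normal_form (\<Sum>i\<in>A. m i) (\<Sum>i\<in>A. m i * weight i)) \<in> I"
    by (rule mult_mem[OF insert.IH])
  note step = this[unfolded right_diff_distrib]
  have "(\<Sum>i\<in>A. m i * weight i) \<le> 4 * (\<Sum>i\<in>A. m i)"
    unfolding sum_distrib_left by (rule sum_mono) (simp add: weight_le mult.commute)
  from ideal_trans_cong[OF ideal step Var_power_mult_normal_form[OF this, of i "m i"]]
  show ?case using insert.hyps by simp
qed (simp_all add: zero_mem)

text \<open>
  The linear map that sends \<open>s\<^sup>d t\<^sup>w\<close> to the normal form of degree \<open>d\<close> and weight \<open>w\<close> inverts the
  parametrization modulo \<open>I\<close>. So a polynomial that the parametrization kills is congruent to \<open>0\<close>.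
\<close>

lemma kernel_subset: "{p. subst rational_normal_curve p = 0} \<subseteq> I"
proof -
  define lift :: "(2, 'k) mpoly \<Rightarrow> (5, 'k) mpoly" where
    "lift = lin_ext (\<lambda>m c. Const c * normal_form (Poly_Mapping.lookup m 0) (Poly_Mapping.lookup m 1))"
  have lift_add: "lift (p + q) = lift p + lift q" for p q
    unfolding lift_def by (rule lin_ext_add) (auto simp: Const_add algebra_simps)
  have lift_0: "lift 0 = 0"
    by (simp add: lift_def lin_ext_def)
  have "p - lift (subst rational_normal_curve p) \<in> I" for p
  proof (induction p rule: additive_induct)
    case zero
    then show ?case by (simp add: lift_0 zero_mem)
  next
    case (add p q)
    then show ?case using add_mem[OF add] by (simp add: subst_add lift_add algebra_simps)
  next
    case (single m c)
    let ?m = "Poly_Mapping.lookup m"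
    let ?d = "\<Sum>i\<in>UNIV. ?m i" and ?w = "\<Sum>i\<in>UNIV. ?m i * weight i"
    have "subst rational_normal_curve (Poly_Mapping.single m c)
        = Const c * (Var 0 ^ ?d * Var 1 ^ ?w)"
      by (simp add: subst_single rational_normal_curve_def power_mult_distrib prod.distrib
          power_sum mult.commute flip: power_mult)
    also have "\<dots> = Poly_Mapping.single (Poly_Mapping.single 0 ?d + Poly_Mapping.single 1 ?w) c"
      by (simp add: Var_power Const_def mult_single)
    finally have "lift (subst rational_normal_curve (Poly_Mapping.single m c)) = Const c * normal_form ?d ?w"
      by (simp add: lift_def lin_ext_single lookup_add lookup_single)
    moreover have "Poly_Mapping.single m c = Const c * (\<Prod>i\<in>UNIV. Var i ^ ?m i)"
      using subst_Var_id[of "Poly_Mapping.single m c"] by (simp add: subst_single)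
    ultimately show ?case
      using mult_mem[OF monomial_normal_form, of "Const c"] by (simp add: right_diff_distrib)
  qed
  then show ?thesis by (metis (mono_tags, lifting) diff_zero lift_0 mem_Collect_eq subsetI)
qed

end

lemma hankel_3_index: "i < 3 \<Longrightarrow> j < 3 \<Longrightarrow> hankel_3 $$ (i, j) = Var (of_nat (i + j))"
  by (simp add: hankel_3_def)

lemma dim_hankel_3 [simp]: "dim_row hankel_3 = 3" "dim_col hankel_3 = 3"
  by (simp_all add: hankel_3_def)

lemma minors_hankel_3:
  "x0 * x2 - x1 ^ 2 \<in> minors 2 hankel_3" "x0 * x3 - x1 * x2 \<in> minors 2 hankel_3"
  "x1 * x3 - x2 ^ 2 \<in> minors 2 hankel_3" "x0 * x4 - x2 ^ 2 \<in> minors 2 hankel_3"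
  "x1 * x4 - x2 * x3 \<in> minors 2 hankel_3" "x2 * x4 - x3 ^ 2 \<in> minors 2 hankel_3"
proof -
  have minor: "Var (of_nat (a + c)) * Var (of_nat (b + d)) - Var (of_nat (a + d)) * Var (of_nat (b + c))
      \<in> minors 2 hankel_3" if "a < b" "b < 3" "c < d" "d < 3" for a b c d
  proof -
    have "Var (of_nat (a + c)) * Var (of_nat (b + d)) - Var (of_nat (a + d)) * Var (of_nat (b + c))
      = hankel_3 $$ (a, c) * hankel_3 $$ (b, d) - hankel_3 $$ (a, d) * hankel_3 $$ (b, c)"
      using that by (simp add: hankel_3_index)
    with that show ?thesis unfolding minors_2_eq mem_Collect_eq
      by (intro exI[of _ a] exI[of _ b] exI[of _ c] exI[of _ d]) simp
  qed
  show "x0 * x2 - x1 ^ 2 \<in> minors 2 hankel_3" "x0 * x3 - x1 * x2 \<in> minors 2 hankel_3"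
  "x1 * x3 - x2 ^ 2 \<in> minors 2 hankel_3" "x0 * x4 - x2 ^ 2 \<in> minors 2 hankel_3"
  "x1 * x4 - x2 * x3 \<in> minors 2 hankel_3" "x2 * x4 - x3 ^ 2 \<in> minors 2 hankel_3"
    using minor[of 0 1 0 1] minor[of 0 1 0 2] minor[of 0 1 1 2] minor[of 0 2 0 2]
       minor[of 0 2 1 2] minor[of 1 2 1 2]
    by (simp_all add: power2_eq_square algebra_simps)
qed

lemma straightening_minors_ideal: "straightening (minors_ideal 2 hankel_3)"
  unfolding minors_ideal_def
  by (rule straightening.intro)
     (use genideal_type_algebra(1,2)[of "minors 2 hankel_3"] minors_hankel_3 in auto)

lemma minors_ideal_hankel_3_eq_kernel:
  "minors_ideal 2 hankel_3 = {p :: (5, 'k::comm_ring_1) mpoly. subst rational_normal_curve p = 0}"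
proof
  let ?K = "{p :: (5, 'k) mpoly. subst rational_normal_curve p = 0}"
  have "ideal ?K ring_of_type_algebra"
    by (auto simp: ideal_type_algebra_iff subst_hom)
  moreover have "minors 2 hankel_3 \<subseteq> ?K"
  proof -
    have "subst rational_normal_curve (hankel_3 $$ (a, b) :: (5, 'k) mpoly) = Var 0 * Var 1 ^ (a + b)"
      if "a < 3" "b < 3" for a b
      using that by (simp add: hankel_3_index rational_normal_curve_def weight_of_nat del: of_nat_add)
    then show ?thesis
      by (auto simp: minors_2_eq subst_hom power_add ac_simps)
  qed
  ultimately show "minors_ideal 2 hankel_3 \<subseteq> ?K"
    unfolding minors_ideal_def by (rule genideal_type_algebra(3))
  show "?K \<subseteq> minors_ideal 2 hankel_3"
    by (rule straightening.kernel_subset[OF straightening_minors_ideal])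
qed

section \<open>The polar map is not birational\<close>

text \<open>
  For the symmetric matrix with rows \<open>(a, b, u)\<close>, \<open>(b, v, c)\<close>, \<open>(u, c, e)\<close>, determinant \<open>D\<close> and
  adjugate \<open>m\<close>, these are the entries of \<open>adj m = D\<close> times the matrix.
\<close>

lemma adjugate_adjugate_symmetric_3:
  fixes a b c u v e :: "'a::comm_ring_1"
  defines "D \<equiv> a * v * e + 2 * b * c * u - u * u * v - a * c * c - b * b * e"
  defines "m11 \<equiv> v * e - c * c" and "m12 \<equiv> u * c - b * e" and "m13 \<equiv> b * c - u * v"
    and "m22 \<equiv> a * e - u * u" and "m23 \<equiv> b * u - a * c" and "m33 \<equiv> a * v - b * b"
  shows "m22 * m33 - m23 * m23 = D * a" "m13 * m23 - m12 * m33 = D * b"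
    "m12 * m23 - m13 * m22 = D * u" "m11 * m33 - m13 * m13 = D * v"
    "m12 * m13 - m11 * m23 = D * c" "m11 * m22 - m12 * m12 = D * e"
  unfolding assms by (simp_all add: algebra_simps)

text \<open>
  Let \<open>A\<close> be the adjugate of the Hankel matrix of \<open>y\<close>, with antidiagonal entries \<open>u\<^sub>0\<close> in the corners
  and \<open>v\<^sub>0\<close> in the middle. Its quadratic relation reads \<open>3 u\<^sub>0\<^sup>2 - k u\<^sub>0 + \<dots> = 0\<close> once \<open>k = 2 u\<^sub>0 + v\<^sub>0\<close>
  and the other entries are fixed. The other root is \<open>k / 3 - u\<^sub>0 = (v\<^sub>0 - u\<^sub>0) / 3\<close>, and the matching
  middle entry is \<open>(8 u\<^sub>0 + v\<^sub>0) / 3\<close>. The symmetric matrix formed by \<open>a, b, c, e, u, v\<close> is three times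
  the matrix with these entries. As it satisfies the relation too, its adjugate is again a Hankel
  matrix, that of \<open>z\<close>, and taking adjugates once more shows that \<open>y\<close> and \<open>z\<close> have proportional
  images under the polar map.
\<close>

lemma hankel_polar_deck_transformation:
  fixes y0 y1 y2 y3 y4 :: "'a::comm_ring_1"
  defines "a \<equiv> 3 * (y2 * y4 - y3\<^sup>2)" and "b \<equiv> 3 * (y2 * y3 - y1 * y4)"
    and "c \<equiv> 3 * (y1 * y2 - y0 * y3)" and "e \<equiv> 3 * (y0 * y2 - y1\<^sup>2)"
    and "u \<equiv> y0 * y4 - y1 * y3"
    and "v \<equiv> y0 * y4 + 8 * y1 * y3 - 9 * y2\<^sup>2"
  defines "z0 \<equiv> v * e - c * c" and "z1 \<equiv> u * c - b * e" and "z2 \<equiv> a * e - u * u"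
    and "z3 \<equiv> b * u - a * c" and "z4 \<equiv> a * v - b * b"
    and "D \<equiv> a * v * e + 2 * b * c * u - u * u * v - a * c * c - b * b * e"
  shows "z2 * z4 - z3\<^sup>2 = 3 * D * (y2 * y4 - y3\<^sup>2)"
    and "2 * (z2 * z3 - z1 * z4) = 3 * D * (2 * (y2 * y3 - y1 * y4))"
    and "z0 * z4 + 2 * z1 * z3 - 3 * z2\<^sup>2 = 3 * D * (y0 * y4 + 2 * y1 * y3 - 3 * y2\<^sup>2)"
    and "2 * (z1 * z2 - z0 * z3) = 3 * D * (2 * (y1 * y2 - y0 * y3))"
    and "z0 * z2 - z1\<^sup>2 = 3 * D * (y0 * y2 - y1\<^sup>2)"
proof -
  \<comment> \<open>The two candidates for the middle coordinate agree by the quadratic relation.\<close>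
  have hankel: "b * c - u * v = z2"
    unfolding a_def b_def c_def e_def u_def v_def z2_def
    by (simp add: power2_eq_square algebra_simps)
  note adj = adjugate_adjugate_symmetric_3[where a = a and b = b and c = c and u = u and v = v and e = e,
      unfolded hankel, folded D_def z0_def z1_def z2_def z3_def z4_def]
  show "z2 * z4 - z3\<^sup>2 = 3 * D * (y2 * y4 - y3\<^sup>2)"
    using adj(1) by (simp add: a_def power2_eq_square algebra_simps)
  show "z0 * z2 - z1\<^sup>2 = 3 * D * (y0 * y2 - y1\<^sup>2)"
    using adj(6) by (simp add: e_def power2_eq_square algebra_simps)
  show "2 * (z2 * z3 - z1 * z4) = 3 * D * (2 * (y2 * y3 - y1 * y4))"
    unfolding adj(2) by (simp add: b_def mult.left_commute mult.assoc)
  show "2 * (z1 * z2 - z0 * z3) = 3 * D * (2 * (y1 * y2 - y0 * y3))"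
    unfolding adj(5) by (simp add: c_def mult.left_commute mult.assoc)
  show "z0 * z4 + 2 * z1 * z3 - 3 * z2\<^sup>2 = 3 * D * (y0 * y4 + 2 * y1 * y3 - 3 * y2\<^sup>2)"
  proof -
    have "z0 * z4 + 2 * z1 * z3 - 3 * z2\<^sup>2 = (z0 * z4 - z2 * z2) + 2 * (z1 * z3 - z2 * z2)"
      by (simp add: power2_eq_square algebra_simps)
    also have "\<dots> = D * (v + 2 * u)"
      unfolding adj(3,4) by (simp add: algebra_simps)
    also have "v + 2 * u = 3 * (y0 * y4 + 2 * y1 * y3 - 3 * y2\<^sup>2)"
      by (simp add: u_def v_def)
    finally show ?thesis by (simp add: mult.left_commute mult.assoc)
  qed
qed

lemma Var_neq_0 [simp]: "Var i \<noteq> (0 :: ('n, 'k::comm_ring_1) mpoly)"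
  by (metis Var_def single_zero inj_single injD one_neq_zero)

text \<open>
  If \<open>G\<close> inverts the polar map \<open>F\<close>, then \<open>g = G \<circ> F\<close> is proportional to the identity. Since \<open>S\<close>
  changes \<open>F\<close> only by a factor, and \<open>G\<close> is homogeneous, \<open>g \<circ> S\<close> is proportional to \<open>g\<close>, and so \<open>S\<close>
  is proportional to the identity. The factor does not vanish identically and \<open>S\<close> is
  not the identity, as the point \<open>(1 : 0 : 0 : 0 : 1)\<close> shows, which \<open>S\<close> sends to
  \<open>(0 : 0 : -1 : 0 : 0)\<close>. Working with \<open>g\<close> instead of the factor by which it differs from the
  identity avoids any discussion of whether \<open>S\<close> is dominant.
\<close>

lemma det_hankel_3_not_homaloidal:
  "\<not> homaloidal (det hankel_3 :: (5, 'k::field_char_0) mpoly)"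
proof
  let ?F = "polar_map (det hankel_3 :: (5, 'k) mpoly)"
  assume "homaloidal (det hankel_3 :: (5, 'k) mpoly)"
  then obtain G e where G: "\<And>i. homogeneous e (G i)"
    and inv: "same_rational_map (compose_map G ?F) Var"
    unfolding homaloidal_def birational_def represents_rational_map_def by blast
  define g where "g i = subst ?F (G i)" for i
  have g_Var: "g i * Var j = g j * Var i" for i j
    using inv by (simp add: same_rational_map_def compose_map_def g_def mult.commute)
  obtain i where "g i \<noteq> 0"
    using inv by (auto simp: same_rational_map_def represents_rational_map_def compose_map_def g_def)
  then have "g 0 \<noteq> 0"
    using g_Var[of i 0] by auto

  define a where "a = 3 * (x2 * x4 - x3\<^sup>2 :: (5, 'k) mpoly)"
  define b where "b = 3 * (x2 * x3 - x1 * x4 :: (5, 'k) mpoly)"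
  define c where "c = 3 * (x1 * x2 - x0 * x3 :: (5, 'k) mpoly)"
  define h where "h = 3 * (x0 * x2 - x1\<^sup>2 :: (5, 'k) mpoly)"
  define u where "u = (x0 * x4 - x1 * x3 :: (5, 'k) mpoly)"
  define v where "v = (x0 * x4 + 8 * x1 * x3 - 9 * x2\<^sup>2 :: (5, 'k) mpoly)"
  define D where "D = a * v * h + 2 * b * c * u - u * u * v - a * c * c - b * b * h"
  define S :: "5 \<Rightarrow> (5, 'k) mpoly" where
    "S i = (if i = 0 then v * h - c * c else if i = 1 then u * c - b * h
       else if i = 2 then a * h - u * u else if i = 3 then b * u - a * c else a * v - b * b)" for i
  have S_simps: "S 0 = v * h - c * c" "S 1 = u * c - b * h" "S 2 = a * h - u * u"
    "S 3 = b * u - a * c" "S 4 = a * v - b * b"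
    by (simp_all add: S_def)
  note deck = hankel_polar_deck_transformation[where ?y0.0 = "x0 :: (5, 'k) mpoly" and ?y1.0 = "x1 :: (5, 'k) mpoly" and ?y2.0 = "x2 :: (5, 'k) mpoly" and ?y3.0 = "x3 :: (5, 'k) mpoly" and ?y4.0 = "x4 :: (5, 'k) mpoly",
      folded a_def b_def c_def h_def u_def v_def, folded D_def]
  have "\<forall>i. subst S (?F i) = 3 * D * ?F i"
    unfolding forall_5 polar_map_det_hankel_3 subst_hom subst_Var subst_numeral S_simps
    by (intro conjI deck)
  then have S_F: "subst S (?F i) = 3 * D * ?F i" for i by blast
  have S_g: "subst S (g i) = (3 * D) ^ e * g i" for i
    unfolding g_def subst_subst S_F by (rule subst_scale_homogeneous[OF G])

  \<comment> \<open>Evaluation at \<open>(1 : 0 : 0 : 0 : 1)\<close>, as a substitution of constants.\<close>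
  define pt :: "5 \<Rightarrow> (5, 'k) mpoly" where "pt i = (if i = 0 \<or> i = 4 then 1 else 0)" for i
  have pt: "subst pt a = 0" "subst pt b = 0" "subst pt c = 0" "subst pt h = 0"
    "subst pt u = 1" "subst pt v = 1"
    by (simp_all add: a_def b_def c_def h_def u_def v_def subst_hom pt_def)
  have "subst pt D = - 1"
    by (simp add: D_def subst_hom pt)
  then have "3 * D \<noteq> 0" by auto

  have "(3 * D) ^ e * (g 0 * S 2) = (3 * D) ^ e * (g 2 * S 0)"
    using arg_cong[OF g_Var[of 0 2], of "subst S"] by (simp add: subst_mult S_g mult.assoc)
  with \<open>3 * D \<noteq> 0\<close> have "g 0 * S 2 = g 2 * S 0" by simp
  then have "g 0 * (S 2 * x0) = (g 2 * S 0) * x0"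
    by (simp only: mult.assoc[symmetric])
  also have "\<dots> = (g 2 * x0) * S 0"
    by (simp only: ac_simps)
  also have "\<dots> = g 0 * (S 0 * x2)"
    unfolding g_Var[of 2 0] by (simp only: ac_simps)
  finally have "g 0 * (S 2 * x0) = g 0 * (S 0 * x2)" .
  with \<open>g 0 \<noteq> 0\<close> have "S 2 * x0 = S 0 * x2" by simp
  then have "subst pt (S 2 * x0) = subst pt (S 0 * x2)" by simp
  then show False
    by (simp add: S_simps subst_hom pt) (simp add: pt_def)
qed

section \<open>The gradient ideal and the missing quadric\<close>

lemma monomial_eq_quadratic_iff:
  fixes m :: "'n \<Rightarrow>\<^sub>0 nat"
  shows "m + Poly_Mapping.single i 1 + Poly_Mapping.single j 1 = Poly_Mapping.single k 1 + Poly_Mapping.single l 1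
    \<longleftrightarrow> m = 0 \<and> (i = k \<and> j = l \<or> i = l \<and> j = k)" (is "?l \<longleftrightarrow> ?r")
proof
  assume eq: ?l
  have single_eq: "m = 0 \<and> a = b" if "m + Poly_Mapping.single a 1 = Poly_Mapping.single b (1::nat)" for a b
  proof -
    have "a = b"
      using arg_cong[OF that, of "\<lambda>p. Poly_Mapping.lookup p a"]
      by (auto simp: lookup_add lookup_single when_def split: if_splits)
    with that show ?thesis by simp
  qed
  have "i = k \<or> i = l"
    using arg_cong[OF eq, of "\<lambda>p. Poly_Mapping.lookup p i"]
    by (auto simp: lookup_add lookup_single when_def split: if_splits)
  then show ?r
  proof
    assume "i = k"
    then have "Poly_Mapping.single k 1 + (m + Poly_Mapping.single j 1) = Poly_Mapping.single k 1 + Poly_Mapping.single l 1"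
      using eq by (simp only: ac_simps)
    with \<open>i = k\<close> show ?r using single_eq[of j l] by (simp only: add_left_cancel simp_thms)
  next
    assume "i = l"
    then have "Poly_Mapping.single l 1 + (m + Poly_Mapping.single j 1) = Poly_Mapping.single l 1 + Poly_Mapping.single k 1"
      using eq by (simp only: ac_simps)
    with \<open>i = l\<close> show ?r using single_eq[of j k] by (simp only: add_left_cancel simp_thms)
  qed
qed (auto simp: add.commute)

lemma lookup_mult_quadratic_monomial:
  "Poly_Mapping.lookup (r * (Var i * Var j)) (Poly_Mapping.single k 1 + Poly_Mapping.single l 1) =
     (Poly_Mapping.lookup r 0 when i = k \<and> j = l \<or> i = l \<and> j = k)"
proof (induction r rule: additive_induct)
  case (single m c)
  show ?case
    using monomial_eq_quadratic_iff[of m i j k l]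
    by (auto simp: Var_def mult_single lookup_single when_def add.assoc simp del: One_nat_def)
qed (simp_all add: distrib_right lookup_add when_def)

text \<open>
  The weights \<open>3\<close> and \<open>2\<close> are chosen so that \<open>x\<^sub>0 x\<^sub>4 + 2 x\<^sub>1 x\<^sub>3 - 3 x\<^sub>2\<^sup>2\<close> is sent to \<open>2 * 3 - 3 * 2 = 0\<close>,
  whereas \<open>x\<^sub>1 x\<^sub>3 - x\<^sub>2\<^sup>2\<close> is sent to \<open>1\<close>. The other derivatives avoid both monomials.
\<close>

definition apolar_pairing :: "(5, 'k::comm_ring_1) mpoly \<Rightarrow> 'k" where
  "apolar_pairing p = 3 * Poly_Mapping.lookup p (Poly_Mapping.single 1 1 + Poly_Mapping.single 3 1)
     + 2 * Poly_Mapping.lookup p (Poly_Mapping.single 2 1 + Poly_Mapping.single 2 1)"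

lemma apolar_pairing_linear:
  "apolar_pairing 0 = 0"
  "apolar_pairing (p + q) = apolar_pairing p + apolar_pairing q"
  "apolar_pairing (p - q) = apolar_pairing p - apolar_pairing q"
  by (simp_all add: apolar_pairing_def lookup_add lookup_minus algebra_simps)

lemma apolar_pairing_mult_quadratic_monomial:
  "apolar_pairing (r * (Var i * Var j)) =
     (if i = 1 \<and> j = 3 \<or> i = 3 \<and> j = 1 then 3 * Poly_Mapping.lookup r 0
      else if i = 2 \<and> j = 2 then 2 * Poly_Mapping.lookup r 0 else 0)"
  unfolding apolar_pairing_def lookup_mult_quadratic_monomial by (auto simp: when_def)

text \<open>
  In degree two a multiple \<open>r * f\<close> of a quadric \<open>f\<close> is \<open>f\<close> times the constant term of \<open>r\<close>. So a
  functional on quadrics that vanishes on generators of degree two vanishes on their ideal; the set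
  \<open>W\<close> is the largest ideal on which it vanishes.
\<close>

lemma extra_quadric_notin_gradient_ideal:
  "x1 * x3 - x2 ^ 2 \<notin> gradient_ideal (det (hankel_3 :: (5, 'k::field) mpoly mat))"
proof
  define W :: "(5, 'k) mpoly set" where "W = {p. \<forall>r. apolar_pairing (r * p) = 0}"
  have W: "ideal W ring_of_type_algebra"
    by (auto simp: ideal_type_algebra_iff W_def apolar_pairing_linear distrib_left simp flip: mult.assoc)
  have "x2 * x3 - x1 * x4 \<in> W" "x1 * x2 - x0 * x3 \<in> W"
    by (simp_all add: W_def right_diff_distrib apolar_pairing_linear apolar_pairing_mult_quadratic_monomial)
  then have "2 * (x2 * x3 - x1 * x4) \<in> W" "2 * (x1 * x2 - x0 * x3) \<in> W"
    using W unfolding ideal_type_algebra_iff by blast+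
  moreover have "x2 * x4 - x3 ^ 2 \<in> W" "x0 * x2 - x1 ^ 2 \<in> W"
    by (simp_all add: W_def right_diff_distrib apolar_pairing_linear
        apolar_pairing_mult_quadratic_monomial power2_eq_square)
  moreover have "x0 * x4 + 2 * x1 * x3 - 3 * x2 ^ 2 \<in> W"
  proof -
    have "r * (x0 * x4 + 2 * x1 * x3 - 3 * x2 ^ 2) =
        r * (x0 * x4) + (r + r) * (x1 * x3) - (r + r + r) * (x2 * x2)" for r :: "(5, 'k) mpoly"
      by (simp add: power2_eq_square algebra_simps)
    note split = this
    show ?thesis
      unfolding W_def mem_Collect_eq split apolar_pairing_linear
        apolar_pairing_mult_quadratic_monomial lookup_add
      by (simp add: distrib_left)
  qed
  ultimately have "gradient_ideal (det hankel_3) \<subseteq> W"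
    unfolding gradient_ideal_conv_polar_map range_polar_map_det_hankel_3
    by (intro genideal_type_algebra(3)[OF W]) blast
  moreover assume "x1 * x3 - x2 ^ 2 \<in> gradient_ideal (det (hankel_3 :: (5, 'k) mpoly mat))"
  ultimately have "apolar_pairing (1 * (x1 * x3 - x2 ^ 2) :: (5, 'k) mpoly) = 0"
    unfolding W_def by blast
  moreover have "apolar_pairing (1 * (x1 * x3 - x2 ^ 2) :: (5, 'k) mpoly) = 1"
    unfolding right_diff_distrib power2_eq_square
    by (simp only: apolar_pairing_linear apolar_pairing_mult_quadratic_monomial) simp
  ultimately show False by simp
qed

context
  fixes J :: "(5, 'k::field_char_0) mpoly set" and q :: "(5, 'k) mpoly"
  defines "J \<equiv> gradient_ideal (det hankel_3)" and "q \<equiv> x1 * x3 - x2 ^ 2"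
begin

lemma J_ideal: "ideal J ring_of_type_algebra"
  unfolding J_def gradient_ideal_def by (rule genideal_type_algebra(1))

lemma J_add: "a \<in> J \<Longrightarrow> b \<in> J \<Longrightarrow> a + b \<in> J" and J_mult: "a \<in> J \<Longrightarrow> r * a \<in> J" and J_0: "0 \<in> J"
  using J_ideal unfolding ideal_type_algebra_iff by blast+

lemma J_mult_numeral_cancel: "numeral w * a \<in> J \<Longrightarrow> a \<in> J"
  using J_mult[of "numeral w * a" "Const (inverse (numeral w))"]
  by (simp flip: mult.assoc Const_numeral Const_mult del: Const_numeral)

lemma J_minors:
  "x2 * x4 - x3 ^ 2 \<in> J" "x2 * x3 - x1 * x4 \<in> J" "x1 * x2 - x0 * x3 \<in> J" "x0 * x2 - x1 ^ 2 \<in> J"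
  and J_middle: "x0 * x4 + 2 * x1 * x3 - 3 * x2 ^ 2 \<in> J"
proof -
  have "{x2 * x4 - x3 ^ 2, 2 * (x2 * x3 - x1 * x4),
     x0 * x4 + 2 * x1 * x3 - 3 * x2 ^ 2, 2 * (x1 * x2 - x0 * x3), x0 * x2 - x1 ^ 2} \<subseteq> J"
    unfolding J_def gradient_ideal_conv_polar_map
    using genideal_type_algebra(2) range_polar_map_det_hankel_3 by metis
  then show "x2 * x4 - x3 ^ 2 \<in> J" "x2 * x3 - x1 * x4 \<in> J" "x1 * x2 - x0 * x3 \<in> J" "x0 * x2 - x1 ^ 2 \<in> J"
    "x0 * x4 + 2 * x1 * x3 - 3 * x2 ^ 2 \<in> J"
    using J_mult_numeral_cancel by (blast+)
qed

text \<open>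
  Four of the derivatives say that \<open>x\<^sub>1\<^sup>2 \<equiv> x\<^sub>0 x\<^sub>2\<close>, \<open>x\<^sub>1 x\<^sub>2 \<equiv> x\<^sub>0 x\<^sub>3\<close>, \<open>x\<^sub>2 x\<^sub>3 \<equiv> x\<^sub>1 x\<^sub>4\<close> and
  \<open>x\<^sub>3\<^sup>2 \<equiv> x\<^sub>2 x\<^sub>4\<close> modulo \<open>J\<close>. For example \<open>x\<^sub>0 x\<^sub>1 x\<^sub>3 \<equiv> x\<^sub>1\<^sup>2 x\<^sub>2 \<equiv> x\<^sub>0 x\<^sub>2\<^sup>2\<close>. Only the multiple \<open>x\<^sub>2 q\<close> needs the
  middle derivative, and division by \<open>3\<close>.
\<close>

lemma Var_mult_extra_quadric: "Var i * q \<in> J"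
proof -
  have *: "r * (x2 * x4 - x3 ^ 2) + s * (x2 * x3 - x1 * x4) + t * (x1 * x2 - x0 * x3) + w * (x0 * x2 - x1 ^ 2)
     + z * (x0 * x4 + 2 * x1 * x3 - 3 * x2 ^ 2) \<in> J" for r s t w z
    by (intro J_add J_mult J_minors J_middle)
  have "x0 * q \<in> J"
    using *[of 0 0 "- x1" "- x2" 0] by (simp add: q_def algebra_simps power2_eq_square)
  moreover have "x1 * q \<in> J"
    using *[of 0 0 "- x2" "- x3" 0] by (simp add: q_def algebra_simps power2_eq_square)
  moreover have "3 * (x2 * q) \<in> J"
    using *[of "- x0" 0 "x3" 0 x2] by (simp add: q_def algebra_simps power2_eq_square)
  moreover have "x3 * q \<in> J"
    using *[of "- x1" "- x2" 0 0 0] by (simp add: q_def algebra_simps power2_eq_square)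
  moreover have "x4 * q \<in> J"
    using *[of "- x2" "- x3" 0 0 0] by (simp add: q_def algebra_simps power2_eq_square)
  ultimately have "\<forall>i. Var i * q \<in> J"
    using J_mult_numeral_cancel by (auto simp: forall_5)
  then show ?thesis ..
qed

lemma irrelevant_ideal_mult_extra_quadric:
  "p \<in> genideal ring_of_type_algebra (range Var) \<Longrightarrow> p * q \<in> J"
proof -
  have "ideal {p. p * q \<in> J} ring_of_type_algebra"
    using J_0 J_add J_mult by (auto simp: ideal_type_algebra_iff distrib_right mult.assoc)
  then have "genideal ring_of_type_algebra (range Var) \<subseteq> {p. p * q \<in> J}"
    by (rule genideal_type_algebra(3)) (use Var_mult_extra_quadric in auto)
  then show "p \<in> genideal ring_of_type_algebra (range Var) \<Longrightarrow> p * q \<in> J" by blast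
qed

text \<open>\<open>J + (q)\<close> contains \<open>P\<close>: the middle derivative and \<open>q\<close> together give back the minor \<open>x\<^sub>0 x\<^sub>4 - x\<^sub>2\<^sup>2\<close>.\<close>

lemma straightening_gradient_ideal_plus_quadric: "straightening {j + c * q | j c. j \<in> J}"
proof (rule straightening.intro)
  let ?K = "{j + c * q | j c. j \<in> J}"
  show K: "ideal ?K ring_of_type_algebra"
    unfolding ideal_type_algebra_iff
  proof (intro conjI ballI allI)
    show "0 \<in> ?K" using J_0 by (auto intro!: exI[of _ 0])
    fix a assume "a \<in> ?K"
    then obtain j c where a: "a = j + c * q" "j \<in> J" by blast
    show "r * a \<in> ?K" for r
      unfolding a(1) distrib_left mult.assoc[symmetric] using J_mult[OF a(2)] by blast
    fix b assume "b \<in> ?K"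
    then obtain j' c' where b: "b = j' + c' * q" "j' \<in> J" by blast
    have "a + b = (j + j') + (c + c') * q" by (simp add: a b algebra_simps)
    then show "a + b \<in> ?K" using J_add[OF a(2) b(2)] by blast
  qed
  have J_K: "a \<in> J \<Longrightarrow> a + c * q \<in> ?K" for a c
    by blast
  show "x2 * x4 - x3 ^ 2 \<in> ?K" "x0 * x2 - x1 ^ 2 \<in> ?K"
    using J_K[OF J_minors(1), of 0] J_K[OF J_minors(4), of 0] by simp_all
  show "x0 * x3 - x1 * x2 \<in> ?K" "x1 * x4 - x2 * x3 \<in> ?K"
    using J_K[OF J_mult[OF J_minors(3), of "- 1"], of 0] J_K[OF J_mult[OF J_minors(2), of "- 1"], of 0]
    by simp_all
  show "x1 * x3 - x2 ^ 2 \<in> ?K"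
    using J_K[OF J_0, of 1] by (simp add: q_def)
  have middle: "x0 * x4 + 2 * x1 * x3 - 3 * x2 ^ 2 + (- 2) * q = x0 * x4 - x2 ^ 2"
    by (simp add: q_def algebra_simps)
  show "x0 * x4 - x2 ^ 2 \<in> ?K"
    using J_K[OF J_middle, of "- 2"] unfolding middle .
qed

lemma associated_primes_gradient_ideal:
  "associated_primes ring_of_type_algebra (quotient_module ring_of_type_algebra J)
    = {minors_ideal 2 hankel_3, genideal ring_of_type_algebra (range Var)}"
proof (rule associated_primes_simple_embedded[where q = q and y = x0])
  let ?P = "minors_ideal 2 hankel_3 :: (5, 'k) mpoly set"
  show "ideal J ring_of_type_algebra" by (rule J_ideal)
  show "primeideal ?P ring_of_type_algebra"
    unfolding minors_ideal_hankel_3_eq_kernel by (rule primeideal_kernel_subst)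
  show "primeideal (genideal ring_of_type_algebra (range Var :: (5, 'k) mpoly set)) ring_of_type_algebra"
    unfolding irrelevant_ideal_eq_kernel by (rule primeideal_kernel_subst)
  show "J \<subseteq> ?P"
    unfolding J_def gradient_ideal_conv_polar_map
  proof (rule genideal_type_algebra(3))
    interpret P: straightening ?P by (rule straightening_minors_ideal)
    show "ideal ?P ring_of_type_algebra" by (rule P.ideal)
    have "(x0 * x4 - x2 ^ 2) + 2 * (x1 * x3 - x2 ^ 2) \<in> ?P"
      by (intro P.add_mem P.mult_mem P.minors)
    then have middle: "x0 * x4 + 2 * x1 * x3 - 3 * x2 ^ 2 \<in> ?P"
      by (simp add: algebra_simps)
    show "range (polar_map (det hankel_3)) \<subseteq> ?P"
      unfolding range_polar_map_det_hankel_3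
      by (intro insert_subsetI empty_subsetI middle P.minors P.mult_mem P.neg_minors)
  qed
  show "q \<in> ?P"
    unfolding q_def by (rule straightening.minors(3)[OF straightening_minors_ideal])
  show "q \<notin> J"
    unfolding J_def q_def by (rule extra_quadric_notin_gradient_ideal)
  show "\<exists>j\<in>J. \<exists>c. p = j + c * q" if "p \<in> ?P" for p
    using straightening.kernel_subset[OF straightening_gradient_ideal_plus_quadric] that
    unfolding minors_ideal_hankel_3_eq_kernel by blast
  show "x0 \<in> genideal ring_of_type_algebra (range Var)"
    by (rule subsetD[OF genideal_type_algebra(2)]) simp
  show "x0 \<notin> ?P"
    by (simp add: minors_ideal_hankel_3_eq_kernel rational_normal_curve_def)
qed (use irrelevant_ideal_maximal irrelevant_ideal_mult_extra_quadric in auto)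

end

theorem proposition3p20:
  fixes R :: "(5, 'k::field_char_0) mpoly ring"
    and H :: "(5, 'k) mpoly mat"
    and J P \<mm> :: "(5, 'k) mpoly set"
  defines "R \<equiv> ring_of_type_algebra"
    and "H \<equiv> hankel_3"
    and "J \<equiv> gradient_ideal (det H)"
    and "P \<equiv> minors_ideal 2 H"
    and "\<mm> \<equiv> Idl\<^bsub>R\<^esub> (range Var)"
  shows "associated_primes R (quotient_module R J) = {P, \<mm>}
    \<and> \<not> homaloidal (det H)"
  unfolding assms
  using associated_primes_gradient_ideal det_hankel_3_not_homaloidal by blast

end
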